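(* In LP$^{\mathrm{MLN}}$ (i.e. with respect to semi-strong equivalence $\equiv_{s,s}$), the S-DL transformation is both SE-preserving and NSE-preserving.
   Context: Atoms are propositional. A rule $r$ is an expression $h_1\vee\cdots\vee h_k\leftarrow b_1,\dots,b_m,\mathit{not}\,c_1,\dots,\mathit{not}\,c_n$; write $H(r)$, $B^+(r)$, $B^-(r)$ for the sets of head, positive body and negative body atoms. A program is a finite set of rules. An interpretation $X$ satisfies $r$ iff $X\cap H(r)\neq\emptyset$ or $B^+(r)\not\subseteq X$ or $B^-(r)\cap X\neq\emptyset$. GL-reduct $P^X=\{H(r)\leftarrow B^+(r) : r\in P,\ B^-(r)\cap X=\emptyset\}$; $X$ is an ASP stable model of $P$ iff $X\models P^X$ and no proper subset of $X$ satisfies $P^X$. Weights of LP$^{\mathrm{MLN}}$ rules are omitted; $X$ is an LP$^{\mathrm{MLN}}$ stable model of $P$ iff $X$ is an ASP stable model of $\{r\in P: X\models r\}$. $P\equiv_{s,s}Q$ iff for every program $R$, $P\cup R$ and $Q\cup R$ have the same LP$^{\mathrm{MLN}}$ stable models. Programs are regarded as tuples of rules; $\langle P,Q\rangle$ is the concatenation. For a tuple $T=\langle r_1,\dots,r_n\rangle$ let $\langle S_1,\dots,S_{3n}\rangle=\langle H(r_1),B^+(r_1),B^-(r_1),\dots,H(r_n),B^+(r_n),B^-(r_n)\rangle$; for nonempty $N'\subseteq\{1,\dots,3n\}$ the independent set is $I_{N'}=\bigcap_{i\in N'}S_i\setminus\bigcup_{j\notin N'}S_j$. The S-DL transformation deletes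 some atom $a\in I$ from an independent set $I$ with $|I|>2$, i.e. removes $a$ from every rule of $T$. For a pair $T=\langle P,Q\rangle$ the result is $\langle P^-,Q^-\rangle$ with $P^-$ the first $|P|$ rules. A transformation type is SE-preserving if for every pair $\langle P,Q\rangle$ and every admissible application $P\equiv_{s,s}Q$ implies $P^-\equiv_{s,s}Q^-$, and NSE-preserving if $P\not\equiv_{s,s}Q$ implies $P^-\not\equiv_{s,s}Q^-$. *)

theory Defs
  imports Main "HOL-Library.FSet"
begin

datatype 'a rule = Rule (Hd: "'a fset") (Bpos: "'a fset") (Bneg: "'a fset")

definition sat_rule :: "'a set \<Rightarrow> 'a rule \<Rightarrow> bool" where
  "sat_rule X r \<longleftrightarrow>
     X \<inter> fset (Hd r) \<noteq> {} \<or> \<not> fset (Bpos r) \<subseteq> X \<or> fset (Bneg r) \<inter> X \<noteq> {}"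

definition sat_prog :: "'a set \<Rightarrow> 'a rule set \<Rightarrow> bool" where
  "sat_prog X P \<longleftrightarrow> (\<forall>r\<in>P. sat_rule X r)"

definition gl_reduct :: "'a rule set \<Rightarrow> 'a set \<Rightarrow> 'a rule set" where
  "gl_reduct P X = {Rule (Hd r) (Bpos r) {||} | r. r \<in> P \<and> fset (Bneg r) \<inter> X = {}}"

definition asp_stable :: "'a rule set \<Rightarrow> 'a set \<Rightarrow> bool" where
  "asp_stable P X \<longleftrightarrow>
     sat_prog X (gl_reduct P X) \<and> \<not> (\<exists>Y. Y \<subset> X \<and> sat_prog Y (gl_reduct P X))"

definition lpmln_stable :: "'a rule set \<Rightarrow> 'a set \<Rightarrow> bool" where
  "lpmln_stable P X \<longleftrightarrow> asp_stable {r \<in> P. sat_rule X r} X"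

definition semi_strong_equiv :: "'a rule set \<Rightarrow> 'a rule set \<Rightarrow> bool" where
  "semi_strong_equiv P Q \<longleftrightarrow>
     (\<forall>R. finite R \<longrightarrow> {X. lpmln_stable (P \<union> R) X} = {X. lpmln_stable (Q \<union> R) X})"

text \<open>
  A program regarded as a tuple is a list of rules; the program it denotes is its set of
  elements. The indices of independent sets start at 1, whence the shift by 1 when selecting
  from the list of components.
\<close>

definition components :: "'a rule list \<Rightarrow> 'a fset list" where
  "components T = concat (map (\<lambda>r. [Hd r, Bpos r, Bneg r]) T)"

definition independent_set :: "'a rule list \<Rightarrow> nat set \<Rightarrow> 'a set" where
  "independent_set T N =
     (\<Inter>i\<in>N. fset (components T ! (i - 1))) -
     (\<Union>j\<in>{1..3 * length T} - N. fset (components T ! (j - 1)))"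

definition delete_atom :: "'a \<Rightarrow> 'a rule \<Rightarrow> 'a rule" where
  "delete_atom a r = Rule (Hd r |-| {|a|}) (Bpos r |-| {|a|}) (Bneg r |-| {|a|})"

text \<open>
  A transformation type is the relation between a tuple and the results of its admissible
  applications.
\<close>

definition S_DL :: "'a rule list \<Rightarrow> 'a rule list \<Rightarrow> bool" where
  "S_DL T T' \<longleftrightarrow>
     (\<exists>N a. N \<noteq> {} \<and> N \<subseteq> {1..3 * length T} \<and> card (independent_set T N) > 2 \<and>
        a \<in> independent_set T N \<and> T' = map (delete_atom a) T)"

definition SE_preserving :: "('a rule list \<Rightarrow> 'a rule list \<Rightarrow> bool) \<Rightarrow> bool" where
  "SE_preserving tr \<longleftrightarrow>
     (\<forall>P Q T'. tr (P @ Q) T' \<longrightarrow> semi_strong_equiv (set P) (set Q) \<longrightarrow>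
        semi_strong_equiv (set (take (length P) T')) (set (drop (length P) T')))"

definition NSE_preserving :: "('a rule list \<Rightarrow> 'a rule list \<Rightarrow> bool) \<Rightarrow> bool" where
  "NSE_preserving tr \<longleftrightarrow>
     (\<forall>P Q T'. tr (P @ Q) T' \<longrightarrow> \<not> semi_strong_equiv (set P) (set Q) \<longrightarrow>
        \<not> semi_strong_equiv (set (take (length P) T')) (set (drop (length P) T')))"

end

theory Submission
  imports Defs
begin

text \<open>
  \<open>P\<close> and \<open>Q\<close> are semi-strongly equivalent iff they are refuted by the same
  pairs \<open>X \<subseteq> Y\<close>, where \<open>(X, Y)\<close> refutes a rule whose positive body lies in \<open>X\<close>, whose
  negative body misses \<open>Y\<close>, and whose head meets \<open>Y\<close> but not \<open>X\<close>. All atoms of an independent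
  set \<open>I\<close> occur in the same components, so whether \<open>(X, Y)\<close> refutes a rule depends on \<open>I\<close> only
  through the truth values of \<open>I \<subseteq> X\<close>, \<open>I \<inter> X = {}\<close> and \<open>I \<inter> Y = {}\<close>. Every combination of
  these that a nonempty set realises is also realised, for a suitable pair, by any given set
  with at least two elements. Both \<open>I\<close> and \<open>I\<close> without the deleted atom are such sets, so
  refuting pairs can be carried over in both directions.
\<close>

definition refutes :: "'a set \<Rightarrow> 'a set \<Rightarrow> 'a rule \<Rightarrow> bool" where
  "refutes X Y r \<longleftrightarrow>
     fset (Bpos r) \<subseteq> X \<and> fset (Bneg r) \<inter> Y = {} \<and>
     fset (Hd r) \<inter> X = {} \<and> fset (Hd r) \<inter> Y \<noteq> {}"

text \<open>Only rules satisfied by \<open>Y\<close> are kept, so \<open>Y\<close> always satisfies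
  the reduct and stability is minimality alone. Given the other clauses of \<open>refutes\<close>
  and \<open>X \<subset> Y\<close>, the clause that the head meets \<open>Y\<close> says that
  \<open>Y\<close> satisfies the rule.\<close>

lemma lpmln_stable_iff_refutes:
  "lpmln_stable P Y \<longleftrightarrow> (\<forall>X. X \<subset> Y \<longrightarrow> (\<exists>r\<in>P. refutes X Y r))"
proof -
  let ?R = "gl_reduct {r \<in> P. sat_rule Y r} Y"
  have "sat_prog Y ?R"
    by (auto simp: sat_prog_def gl_reduct_def sat_rule_def)
  moreover have "\<not> sat_prog X ?R \<longleftrightarrow> (\<exists>r\<in>P. refutes X Y r)" if "X \<subset> Y" for X
  proof -
    have "\<not> sat_prog X ?R \<longleftrightarrow>
        (\<exists>r\<in>P. sat_rule Y r \<and> fset (Bneg r) \<inter> Y = {} \<and>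
           \<not> sat_rule X (Rule (Hd r) (Bpos r) {||}))"
      by (auto simp: sat_prog_def gl_reduct_def)
    moreover have "sat_rule Y r \<and> fset (Bneg r) \<inter> Y = {} \<and>
        \<not> sat_rule X (Rule (Hd r) (Bpos r) {||}) \<longleftrightarrow> refutes X Y r" for r
      using that by (auto simp: sat_rule_def refutes_def)
    ultimately show ?thesis by simp
  qed
  ultimately show ?thesis
    by (auto simp: lpmln_stable_def asp_stable_def)
qed

text \<open>If \<open>(X, Y)\<close> refuted a rule of \<open>Q\<close> but none of
  \<open>P\<close>, the context \<open>R\<close> would make \<open>Y\<close> stable for
  \<open>Q \<union> R\<close> but not for \<open>P \<union> R\<close>: the facts force
  \<open>X\<close>, and the links make the rest of \<open>Y\<close> all or nothing. Finiteness of
  \<open>Y\<close> makes \<open>R\<close> a program.\<close>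

lemma semi_strong_equiv_refutes_finite:
  assumes eq: "semi_strong_equiv P Q" and "finite Y" "X \<subseteq> Y"
    and Q: "\<exists>r\<in>Q. refutes X Y r"
  shows "\<exists>r\<in>P. refutes X Y r"
proof (rule ccontr)
  assume P: "\<not> (\<exists>r\<in>P. refutes X Y r)"
  define facts where "facts = (\<lambda>x. Rule {|x|} {||} {||}) ` X"
  define links where "links = (\<lambda>(a, b). Rule {|a|} {|b|} {||}) ` ((Y - X) \<times> (Y - X))"
  \<comment> \<open>The only proper subset of \<open>Y\<close> satisfying the rules of \<open>R\<close> is \<open>X\<close>.\<close>
  define R where "R = facts \<union> links"
  have "finite X"
    using \<open>finite Y\<close> \<open>X \<subseteq> Y\<close> by (rule rev_finite_subset)
  then have "finite R"
    using \<open>finite Y\<close> by (simp add: R_def facts_def links_def)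
  have "X \<subset> Y"
    using Q \<open>X \<subseteq> Y\<close> unfolding refutes_def by blast
  have "\<not> refutes X Y r" if "r \<in> R" for r
    using that by (auto simp: R_def facts_def links_def refutes_def)
  then have "\<not> lpmln_stable (P \<union> R) Y"
    using P \<open>X \<subset> Y\<close> unfolding lpmln_stable_iff_refutes by blast
  moreover have "\<exists>r\<in>Q \<union> R. refutes Z Y r" if Z: "Z \<subset> Y" for Z
  proof (cases "Z = X")
    case True
    then show ?thesis using Q by blast
  next
    case False
    show ?thesis
    proof (cases "X \<subseteq> Z")
      case True
      \<comment> \<open>Here \<open>Z\<close> lies strictly between \<open>X\<close> and
        \<open>Y\<close>, so some link has its body in \<open>Z\<close> and its head
        outside.\<close>
      then obtain b where b: "b \<in> Z" "b \<notin> X" using False by blast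
      obtain a where a: "a \<in> Y" "a \<notin> Z" using Z by blast
      have "Rule {|a|} {|b|} {||} \<in> links"
        using a b Z True unfolding links_def by (intro image_eqI[of _ _ "(a, b)"]) auto
      moreover have "refutes Z Y (Rule {|a|} {|b|} {||})"
        using a b by (simp add: refutes_def)
      ultimately show ?thesis unfolding R_def by blast
    next
      case False
      then obtain x where x: "x \<in> X" "x \<notin> Z" by blast
      then have "refutes Z Y (Rule {|x|} {||} {||})"
        using \<open>X \<subseteq> Y\<close> by (auto simp: refutes_def)
      then show ?thesis using x(1) unfolding R_def facts_def by blast
    qed
  qed
  then have "lpmln_stable (Q \<union> R) Y"
    by (simp add: lpmln_stable_iff_refutes)
  ultimately show False
    using eq \<open>finite R\<close> unfolding semi_strong_equiv_def by blast
qed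

definition rule_atoms :: "'a rule \<Rightarrow> 'a set" where
  "rule_atoms r = fset (Hd r) \<union> fset (Bpos r) \<union> fset (Bneg r)"

lemma refutes_restrict:
  assumes "rule_atoms r \<subseteq> A"
  shows "refutes (X \<inter> A) (Y \<inter> A) r \<longleftrightarrow> refutes X Y r"
  using assms by (auto simp: refutes_def rule_atoms_def)

lemma semi_strong_equiv_iff_refutes:
  assumes "finite P" "finite Q"
  shows "semi_strong_equiv P Q \<longleftrightarrow>
    (\<forall>X Y. X \<subseteq> Y \<longrightarrow> (\<exists>r\<in>P. refutes X Y r) = (\<exists>r\<in>Q. refutes X Y r))"
    (is "?L = ?R")
proof
  assume eq: ?L
  then have eq': "semi_strong_equiv Q P"
    by (simp add: semi_strong_equiv_def)
  \<comment> \<open>Possibly infinite pairs are cut down to the finitely many atoms of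
    \<open>P\<close> and \<open>Q\<close>, which does not affect the rules they refute.\<close>
  define A where "A = (\<Union>r\<in>P \<union> Q. rule_atoms r)"
  have "finite A"
    using assms by (simp add: A_def rule_atoms_def)
  show ?R
  proof (intro allI impI)
    fix X Y :: "'a set"
    assume "X \<subseteq> Y"
    have *: "refutes (X \<inter> A) (Y \<inter> A) r \<longleftrightarrow> refutes X Y r" if "r \<in> P \<union> Q" for r
      using that by (intro refutes_restrict) (auto simp: A_def)
    have "finite (Y \<inter> A)" "X \<inter> A \<subseteq> Y \<inter> A"
      using \<open>finite A\<close> \<open>X \<subseteq> Y\<close> by auto
    then have "(\<exists>r\<in>P. refutes (X \<inter> A) (Y \<inter> A) r) = (\<exists>r\<in>Q. refutes (X \<inter> A) (Y \<inter> A) r)"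
      using semi_strong_equiv_refutes_finite[OF eq] semi_strong_equiv_refutes_finite[OF eq']
      by (intro iffI)
    then show "(\<exists>r\<in>P. refutes X Y r) = (\<exists>r\<in>Q. refutes X Y r)"
      using * by auto
  qed
next
  assume ?R
  then show ?L
    by (simp add: semi_strong_equiv_def lpmln_stable_iff_refutes bex_Un psubset_imp_subset
      cong: imp_cong)
qed

lemma transfer_pair:
  assumes "X \<subseteq> Y" "I \<noteq> {}" "I \<subseteq> K" "J \<subseteq> K" "b \<in> J" "c \<in> J" "b \<noteq> c"
  obtains X' Y' where "X' \<subseteq> Y'" "X' - K = X - K" "Y' - K = Y - K"
    "J \<subseteq> X' \<longleftrightarrow> I \<subseteq> X" "J \<inter> X' = {} \<longleftrightarrow> I \<inter> X = {}" "J \<inter> Y' = {} \<longleftrightarrow> I \<inter> Y = {}"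
proof -
  consider "I \<subseteq> X" | "I \<inter> Y = {}" | "I \<inter> X = {}" "I \<inter> Y \<noteq> {}"
    | "\<not> I \<subseteq> X" "I \<inter> X \<noteq> {}" by blast
  then show thesis
  proof cases
    case 1
    then show ?thesis using assms by (intro that[of "X \<union> J" "Y \<union> J"]) blast+
  next
    case 2
    then show ?thesis using assms by (intro that[of "X - J" "Y - J"]) blast+
  next
    case 3
    then show ?thesis using assms by (intro that[of "X - J" "Y \<union> J"]) blast+
  next
    case 4
    \<comment> \<open>A part of \<open>J\<close> that is neither empty nor all of it is needed:
      \<open>b\<close> is put into the new \<open>X\<close> and \<open>c\<close> stays out.\<close>
    then show ?thesis using assms by (intro that[of "X - J \<union> {b}" "Y \<union> J"]) blast+
  qed
qed

text \<open>\<open>K\<close> holds both blocks, so exchanging \<open>I\<close> and \<open>J\<close>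
  reverses the relation; deleting an atom and restoring it are instances of one notion.\<close>

definition swaps_block :: "'a set \<Rightarrow> 'a set \<Rightarrow> 'a set \<Rightarrow> 'a set \<Rightarrow> 'a set \<Rightarrow> bool" where
  "swaps_block K I J S S' \<longleftrightarrow> S - K = S' - K \<and>
     (S \<inter> K = I \<and> S' \<inter> K = J \<or> S \<inter> K = {} \<and> S' \<inter> K = {})"

lemma swaps_block_sym: "swaps_block K I J S S' \<Longrightarrow> swaps_block K J I S' S"
  by (auto simp: swaps_block_def)

text \<open>Inclusion splits at \<open>K\<close>: outside it nothing changes, and inside it the two
  sets are the two blocks or both empty.\<close>

lemma swaps_block_subset_iff:
  assumes "swaps_block K I J S S'" "X' - K = X - K" "J \<subseteq> X' \<longleftrightarrow> I \<subseteq> X"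
  shows "S' \<subseteq> X' \<longleftrightarrow> S \<subseteq> X"
proof -
  have "S \<subseteq> X \<longleftrightarrow> S - K \<subseteq> X - K \<and> S \<inter> K \<subseteq> X" "S' \<subseteq> X' \<longleftrightarrow> S' - K \<subseteq> X' - K \<and> S' \<inter> K \<subseteq> X'"
    by blast+
  then show ?thesis using assms by (auto simp: swaps_block_def)
qed

lemma swaps_block_disjoint_iff:
  assumes "swaps_block K I J S S'" "X' - K = X - K" "J \<inter> X' = {} \<longleftrightarrow> I \<inter> X = {}"
  shows "S' \<inter> X' = {} \<longleftrightarrow> S \<inter> X = {}"
proof -
  have "S \<inter> X = {} \<longleftrightarrow> (S - K) \<inter> (X - K) = {} \<and> (S \<inter> K) \<inter> X = {}"
    "S' \<inter> X' = {} \<longleftrightarrow> (S' - K) \<inter> (X' - K) = {} \<and> (S' \<inter> K) \<inter> X' = {}"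
    by blast+
  then show ?thesis using assms by (auto simp: swaps_block_def)
qed

definition rule_swaps_block :: "'a set \<Rightarrow> 'a set \<Rightarrow> 'a set \<Rightarrow> 'a rule \<Rightarrow> 'a rule \<Rightarrow> bool" where
  "rule_swaps_block K I J r r' \<longleftrightarrow>
     swaps_block K I J (fset (Hd r)) (fset (Hd r')) \<and>
     swaps_block K I J (fset (Bpos r)) (fset (Bpos r')) \<and>
     swaps_block K I J (fset (Bneg r)) (fset (Bneg r'))"

lemma rule_swaps_block_sym: "rule_swaps_block K I J r r' \<Longrightarrow> rule_swaps_block K J I r' r"
  by (simp add: rule_swaps_block_def swaps_block_sym)

text \<open>The new pair is chosen before the rules, so a single pair serves whole programs at
  once.\<close>

lemma transfer_refuting_pair:
  assumes "X \<subseteq> Y" "I \<noteq> {}" "I \<subseteq> K" "J \<subseteq> K" "b \<in> J" "c \<in> J" "b \<noteq> c"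
  obtains X' Y' where "X' \<subseteq> Y'"
    "\<And>r r'. rule_swaps_block K I J r r' \<Longrightarrow> refutes X' Y' r' \<longleftrightarrow> refutes X Y r"
proof -
  obtain X' Y' where *: "X' \<subseteq> Y'" "X' - K = X - K" "Y' - K = Y - K"
    "J \<subseteq> X' \<longleftrightarrow> I \<subseteq> X" "J \<inter> X' = {} \<longleftrightarrow> I \<inter> X = {}" "J \<inter> Y' = {} \<longleftrightarrow> I \<inter> Y = {}"
    using transfer_pair[OF assms] .
  have "refutes X' Y' r' \<longleftrightarrow> refutes X Y r" if "rule_swaps_block K I J r r'" for r r'
    using that swaps_block_subset_iff[OF _ *(2,4)] swaps_block_disjoint_iff[OF _ *(2,5)]
      swaps_block_disjoint_iff[OF _ *(3,6)]
    unfolding refutes_def rule_swaps_block_def by metis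
  with *(1) show thesis by (rule that)
qed

text \<open>Each pair for the rules \<open>f r\<close> is moved to one for the rules
  \<open>g r\<close>, where equivalence is given. Keeping both \<open>f\<close> and \<open>g\<close>
  general lets either be the deletion.\<close>

lemma semi_strong_equiv_image_if:
  assumes fin: "finite P" "finite Q"
    and eq: "semi_strong_equiv (g ` P) (g ` Q)"
    and I: "I \<noteq> {}" "I \<subseteq> K" and J: "J \<subseteq> K" "b \<in> J" "c \<in> J" "b \<noteq> c"
    and swap: "\<And>r. r \<in> P \<union> Q \<Longrightarrow> rule_swaps_block K I J (f r) (g r)"
  shows "semi_strong_equiv (f ` P) (f ` Q)"
proof -
  have "(\<exists>r\<in>f ` P. refutes X Y r) = (\<exists>r\<in>f ` Q. refutes X Y r)" if XY: "X \<subseteq> Y" for X Y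
  proof -
    obtain X' Y' where "X' \<subseteq> Y'"
      and tr: "\<And>r r'. rule_swaps_block K I J r r' \<Longrightarrow> refutes X' Y' r' \<longleftrightarrow> refutes X Y r"
      using transfer_refuting_pair[OF XY I J] by blast
    then have "(\<exists>r\<in>P. refutes X' Y' (g r)) = (\<exists>r\<in>Q. refutes X' Y' (g r))"
      using eq fin by (simp add: semi_strong_equiv_iff_refutes)
    then show ?thesis using tr[OF swap] by auto
  qed
  then show ?thesis using fin by (simp add: semi_strong_equiv_iff_refutes)
qed

lemma independent_set_component:
  assumes "S \<in> set (components T)"
  shows "independent_set T N \<subseteq> fset S \<or> independent_set T N \<inter> fset S = {}"
proof -
  have len: "length (components T) = 3 * length T"
    by (induction T) (simp_all add: components_def)
  obtain k where k: "k < 3 * length T" "S = components T ! k"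
    using assms len by (metis in_set_conv_nth)
  \<comment> \<open>List positions start at 0, the indices in \<open>N\<close> at 1.\<close>
  then have "Suc k \<in> {1..3 * length T}" "S = components T ! (Suc k - 1)"
    by simp_all
  then show ?thesis
    unfolding independent_set_def by (cases "Suc k \<in> N") blast+
qed

text \<open>Every component contains the whole independent set or misses it, so removing
  \<open>a\<close> shrinks the block or changes nothing.\<close>

lemma delete_atom_swaps_block:
  assumes "r \<in> set T" "a \<in> independent_set T N"
  shows "rule_swaps_block (independent_set T N) (independent_set T N)
    (independent_set T N - {a}) r (delete_atom a r)"
proof -
  have "{Hd r, Bpos r, Bneg r} \<subseteq> set (components T)"
    using assms(1) by (auto simp: components_def)
  then have *: "independent_set T N \<subseteq> fset S \<or> independent_set T N \<inter> fset S = {}"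
    if "S \<in> {Hd r, Bpos r, Bneg r}" for S
    using that by (intro independent_set_component) blast
  have "swaps_block (independent_set T N) (independent_set T N)
    (independent_set T N - {a}) (fset S) (fset S - {a})" if "S \<in> {Hd r, Bpos r, Bneg r}" for S
    using *[OF that] assms(2) by (auto simp: swaps_block_def)
  then show ?thesis
    by (simp add: rule_swaps_block_def delete_atom_def)
qed

lemma semi_strong_equiv_delete_atom_iff:
  assumes a: "a \<in> independent_set (P @ Q) N" and card: "card (independent_set (P @ Q) N) > 2"
  shows "semi_strong_equiv (delete_atom a ` set P) (delete_atom a ` set Q) \<longleftrightarrow>
    semi_strong_equiv (set P) (set Q)"
proof -
  define I where "I = independent_set (P @ Q) N"
  \<comment> \<open>The bound on the cardinality leaves two atoms after the deletion, as required of
    a target block.\<close>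
  have "card (I - {a}) \<ge> 2"
    using a card by (simp add: I_def)
  then obtain b c where bc: "b \<in> I - {a}" "c \<in> I - {a}" "b \<noteq> c"
    by (meson card_2_iff' obtain_subset_with_card_n subsetD)
  have swap: "rule_swaps_block I I (I - {a}) (id r) (delete_atom a r)"
    if "r \<in> set P \<union> set Q" for r
    using delete_atom_swaps_block[OF _ a] that by (simp add: I_def)
  have "semi_strong_equiv (id ` set P) (id ` set Q)"
    if "semi_strong_equiv (delete_atom a ` set P) (delete_atom a ` set Q)"
    using bc swap
    by (intro semi_strong_equiv_image_if[OF _ _ that, where I = I and J = "I - {a}" and K = I
      and b = b and c = c]) auto
  \<comment> \<open>The blocks trade places: \<open>I\<close> is now the target and still contains
    \<open>b\<close> and \<open>c\<close>.\<close>
  moreover have "semi_strong_equiv (delete_atom a ` set P) (delete_atom a ` set Q)"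
    if "semi_strong_equiv (id ` set P) (id ` set Q)"
    using bc rule_swaps_block_sym[OF swap]
    by (intro semi_strong_equiv_image_if[OF _ _ that, where I = "I - {a}" and J = I and K = I
      and b = b and c = c]) auto
  ultimately show ?thesis by auto
qed

theorem theorem3:
  "SE_preserving (S_DL :: 'a rule list \<Rightarrow> 'a rule list \<Rightarrow> bool) \<and>
   NSE_preserving (S_DL :: 'a rule list \<Rightarrow> 'a rule list \<Rightarrow> bool)"
proof -
  have "semi_strong_equiv (set (take (length P) T')) (set (drop (length P) T')) \<longleftrightarrow>
    semi_strong_equiv (set P) (set Q)" if "S_DL (P @ Q) T'" for P Q T' :: "'a rule list"
    using that by (auto simp: S_DL_def semi_strong_equiv_delete_atom_iff)
  then show ?thesis
    by (simp add: SE_preserving_def NSE_preserving_def)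
qed

end
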